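(* For every sequence of natural numbers $(s_n)_{n\ge1}$ there is a sequence $(Q_1^n,Q_2^n)_{n\ge1}$ of pairs of finite ordered sets such that for every $n$: (1) $Q_1^n$ is not isomorphic to $Q_2^n$; (2) $Q_1^n$ and $Q_2^n$ have equal maximal decks and equal minimal decks; (3) there are ranks $r_0,\ldots,r_n$ such that $Q_1^n$ and $Q_2^n$ have equal marked rank $r_i$ decks for each $i$, and the ranks $r_1,\ldots,r_n$ contain no extremal (maximal or minimal) elements; (4) for each rank $k$ there is at least one element of rank $k$ in $Q_1^n$ and one in $Q_2^n$ such that removing them produces isomorphic marked rank $k$ cards; (5) for all the isomorphic cards $Q_1^n\setminus\{x\}$ and $Q_2^n\setminus\{y\}$ mentioned in (2)–(4), the neighborhoods $\updownarrow_{Q_1^n}x$ and $\updownarrow_{Q_2^n}y$ are isomorphic; (7) for every rank $k$, the rank $k$ neighborhood decks of $Q_1^n$ and $Q_2^n$ are equal; (8) $Q_1^n$ and $Q_2^n$ each have at least $s_n$ maximal elements, at least $s_n$ minimal elements, and for each $r_i$ at least $s_n$ elements of rank $r_i$; and moreover (6) $\liminf_{n\to\infty}ECR(Q_1^n,Q_2^n)\ge\frac1{10}$.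
   Context: All ordered sets are finite. The rank of $x\in P$ is the length (number of elements minus one) of the longest chain whose smallest element is a minimal element of $P$ and whose largest element is $x$. A card of $P$ is $P\setminus\{x\}$ with the induced order; rank $k$ cards/deck: those with $x$ of rank $k$; maximal (minimal) deck: the multiset of cards $P\setminus\{x\}$ with $x$ maximal (minimal). Decks are equal if there is a bijection with each card isomorphic to its image. A marked rank $k$ card carries the information of the rank each element had in the original set; marked cards are equal if there is an isomorphism preserving these original ranks, and marked decks are equal if there is a bijection such that each card is isomorphic to its image via such a rank-preserving isomorphism. The neighborhood of $x$ is $\updownarrow x=\{p:p\ge x\}\cup\{p:p\le x\}$ with the induced order; the rank $k$ neighborhood deck is the multiset of neighborhoods of rank $k$ points, and such decks are equal if there is a bijection with each neighborhood isomorphic to its image. For ordered sets $P_1,P_2$ of the same size $N$, $ECR(P_1,P_2)$ is the number of isomorphic cards (cards of $P_1$ that can be bijectively paired with isomorphic cards of $P_2$) divided by $N$. *)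

theory Defs
  imports Complex_Main "HOL-Library.Extended_Real" "HOL-Library.Liminf_Limsup"
begin

text \<open>An ordered set is given by its (reflexive) order relation; its points are the field of that
  relation.\<close>

definition fin_ordered_set :: "'a rel \<Rightarrow> bool" where
  "fin_ordered_set P \<longleftrightarrow> finite (Field P) \<and> Partial_order P"

text \<open>By \<open>iso_iff2\<close>, the library's \<open>iso P Q f\<close> says, for arbitrary relations, that \<open>f\<close> is a bijection
  between the fields which preserves and reflects the relations.\<close>

definition order_isomorphic :: "'a rel \<Rightarrow> 'b rel \<Rightarrow> bool" where
  "order_isomorphic P Q \<longleftrightarrow> (\<exists>f. iso P Q f)"

definition minimals :: "'a rel \<Rightarrow> 'a set" where
  "minimals P = {x \<in> Field P. \<forall>y \<in> Field P. (y, x) \<in> P \<longrightarrow> y = x}"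

definition maximals :: "'a rel \<Rightarrow> 'a set" where
  "maximals P = {x \<in> Field P. \<forall>y \<in> Field P. (x, y) \<in> P \<longrightarrow> y = x}"

definition chains_to :: "'a rel \<Rightarrow> 'a \<Rightarrow> 'a set set" where
  "chains_to P x = {C. C \<subseteq> Field P \<and> linear_order_on C (Restr P C) \<and>
     (\<exists>m \<in> C. m \<in> minimals P \<and> (\<forall>c \<in> C. (m, c) \<in> P)) \<and>
     x \<in> C \<and> (\<forall>c \<in> C. (c, x) \<in> P)}"

definition order_rank :: "'a rel \<Rightarrow> 'a \<Rightarrow> nat" where
  "order_rank P x = Max ((\<lambda>C. card C - 1) ` chains_to P x)"

definition rank_level :: "'a rel \<Rightarrow> nat \<Rightarrow> 'a set" where
  "rank_level P k = {x \<in> Field P. order_rank P x = k}"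

definition del_point :: "'a rel \<Rightarrow> 'a \<Rightarrow> 'a rel" where
  "del_point P x = Restr P (Field P - {x})"

definition nbhd :: "'a rel \<Rightarrow> 'a \<Rightarrow> 'a rel" where
  "nbhd P x = Restr P ({p. (x, p) \<in> P} \<union> {p. (p, x) \<in> P})"

definition nbhds_iso :: "'a rel \<Rightarrow> 'b rel \<Rightarrow> 'a \<Rightarrow> 'b \<Rightarrow> bool" where
  "nbhds_iso P Q x y \<longleftrightarrow> order_isomorphic (nbhd P x) (nbhd Q y)"

definition cards_iso :: "'a rel \<Rightarrow> 'b rel \<Rightarrow> 'a \<Rightarrow> 'b \<Rightarrow> bool" where
  "cards_iso P Q x y \<longleftrightarrow> order_isomorphic (del_point P x) (del_point Q y)"

text \<open>The ranks preserved here are those in the original ordered sets \<open>P\<close> and \<open>Q\<close>, not the ranks in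
  the cards.\<close>

definition marked_cards_iso :: "'a rel \<Rightarrow> 'b rel \<Rightarrow> 'a \<Rightarrow> 'b \<Rightarrow> bool" where
  "marked_cards_iso P Q x y \<longleftrightarrow>
     (\<exists>f. iso (del_point P x) (del_point Q y) f \<and>
       (\<forall>z \<in> Field P - {x}. order_rank Q (f z) = order_rank P z))"

text \<open>Decks are families of cards (or neighborhoods) indexed by points. Two decks are equal if there is
  a bijection \<open>f\<close> between the index sets such that the cards at \<open>x\<close> and \<open>f x\<close> are isomorphic; \<open>R\<close> is
  the relevant notion of isomorphism, or the conjunction of several to be met by the same bijection.\<close>

definition matched :: "('a \<Rightarrow> 'b \<Rightarrow> bool) \<Rightarrow> 'a set \<Rightarrow> 'b set \<Rightarrow> bool" where
  "matched R A B \<longleftrightarrow> (\<exists>f. bij_betw f A B \<and> (\<forall>x \<in> A. R x (f x)))"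

text \<open>The equal card ratio, meant for ordered sets of the same size: the largest number of cards
  of \<open>P\<close> that can be paired injectively with isomorphic cards of \<open>Q\<close>, divided by the size.\<close>

definition ECR :: "'a rel \<Rightarrow> 'b rel \<Rightarrow> real" where
  "ECR P Q = real (Max {card A | A B. A \<subseteq> Field P \<and> B \<subseteq> Field Q \<and>
                 matched (cards_iso P Q) A B}) / real (card (Field P))"

lemma finite_chains_to: "fin_ordered_set P \<Longrightarrow> finite (chains_to P x)"
  by (rule finite_subset[of _ "Pow (Field P)"]) (auto simp: chains_to_def fin_ordered_set_def)

lemma chains_to_nonempty:
  assumes "fin_ordered_set P" and "x \<in> Field P"
  shows "chains_to P x \<noteq> {}"
proof -
  have po: "Partial_order P" and "finite (Field P \<times> Field P)"
    using assms(1) by (simp_all add: fin_ordered_set_def)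
  moreover have "P \<subseteq> Field P \<times> Field P" by (auto simp: Field_def)
  ultimately have fin: "finite P" using finite_subset by blast
  have rf: "\<And>y. y \<in> Field P \<Longrightarrow> (y, y) \<in> P" and tr: "trans P" and as: "antisym P"
    using po by (simp_all add: order_on_defs refl_on_def)
  have x: "(x, x) \<in> P" using rf assms(2) by blast
  have "wf (P - Id)"
    using fin po by (rule partial_order_on_well_order_on)
  then obtain m where "m \<in> {y. (y, x) \<in> P}" and "\<And>y. (y, m) \<in> P - Id \<Longrightarrow> y \<notin> {y. (y, x) \<in> P}"
    by (rule wfE_min[where x = x and Q = "{y. (y, x) \<in> P}"]) (simp_all add: x)
  then have m: "(m, x) \<in> P" "\<And>y. (y, m) \<in> P - Id \<Longrightarrow> (y, x) \<notin> P" by simp_all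
  have mF: "m \<in> Field P" using m(1) by (rule FieldI1)
  have "y = m" if "(y, m) \<in> P" for y
  proof (rule ccontr)
    assume "y \<noteq> m"
    then show False using m(2)[of y] that transD[OF tr that m(1)] by simp
  qed
  then have min: "m \<in> minimals P" unfolding minimals_def using mF by blast
  have mm: "(m, m) \<in> P" using rf mF by blast
  have "linear_order_on {m, x} (Restr P {m, x})"
    unfolding order_on_defs
  proof (intro conjI)
    show "trans (Restr P {m, x})" using tr by (rule trans_Restr)
    show "antisym (Restr P {m, x})" using as by (rule antisym_Restr)
  qed (use x mm m(1) in \<open>auto simp: refl_on_def total_on_def\<close>)
  then have "{m, x} \<in> chains_to P x"
    unfolding chains_to_def using min x mm m(1) mF assms(2) by blast
  then show ?thesis by blast
qed

end

theory Submission
  imports Defs "HOL-Library.Countable"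
begin

text \<open>Arrange \<open>m\<close> two-point fibres, the pairs, in a cycle. Consecutive fibres are joined by all four
  gates, and a single link point, by being comparable to two of the four gates, selects one of the two
  perfect matchings between the fibres. Up to switching fibres only the parity of the number of
  twisted matchings matters: for even parity the selected gates form two cycles of length \<open>m\<close>, for
  odd parity one of length \<open>2 * m\<close>, so the two orders are not isomorphic. Removing any single link, or
  passing to a neighborhood that misses some link, makes the parity invisible, because the twist can
  be switched to that link. All extremal points and all points of the special ranks are links, every
  rank contains links, and links are a seventh of all points.\<close>

section \<open>Isomorphisms and ranks\<close>

lemma fin_ordered_set_refl: "fin_ordered_set P \<Longrightarrow> x \<in> Field P \<Longrightarrow> (x, x) \<in> P"
  by (auto simp: fin_ordered_set_def order_on_defs refl_on_def)

lemma Field_Restr_refl: "(\<And>x. x \<in> A \<Longrightarrow> (x, x) \<in> P) \<Longrightarrow> Field (Restr P A) = A"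
  by (auto simp: Field_def)

lemma isoD:
  assumes "iso P Q f" "x \<in> Field P" "y \<in> Field P"
  shows "(f x, f y) \<in> Q \<longleftrightarrow> (x, y) \<in> P"
  using assms by (simp add: iso_iff2)

lemma iso_image: "iso P Q f \<Longrightarrow> f ` Field P = Field Q"
  by (simp add: iso_iff2 bij_betw_def)

lemma iso_inj: "iso P Q f \<Longrightarrow> inj_on f (Field P)"
  by (simp add: iso_iff2 bij_betw_def)

text \<open>Reflexivity of \<open>P\<close> makes the field of the restriction all of
  \<open>A\<close>. Both \<open>del_point\<close> and \<open>nbhd\<close> are such
  restrictions.\<close>

lemma iso_Restr:
  assumes P: "fin_ordered_set P" and f: "iso P Q f" and A: "A \<subseteq> Field P"
  shows "iso (Restr P A) (Restr Q (f ` A)) f"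
proof -
  have "Field (Restr P A) = A"
    using A fin_ordered_set_refl[OF P] by (intro Field_Restr_refl) auto
  moreover have "Field (Restr Q (f ` A)) = f ` A"
    using A fin_ordered_set_refl[OF P] isoD[OF f] by (intro Field_Restr_refl) auto
  moreover have "inj_on f A" using iso_inj[OF f] A by (rule inj_on_subset)
  ultimately show ?thesis
    using A isoD[OF f] by (auto simp: iso_iff2 bij_betw_def subset_iff)
qed

lemma iso_del_point:
  assumes "fin_ordered_set P" "iso P Q f" "x \<in> Field P"
  shows "iso (del_point P x) (del_point Q (f x)) f"
proof -
  have "f ` (Field P - {x}) = Field Q - {f x}"
    using iso_image[OF assms(2)] iso_inj[OF assms(2)] assms(3)
    by (auto simp: inj_on_def)
  then show ?thesis
    using iso_Restr[OF assms(1,2), of "Field P - {x}"] by (simp add: del_point_def)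
qed

lemma iso_nbhd:
  assumes "fin_ordered_set P" "iso P Q f" "x \<in> Field P"
  shows "iso (nbhd P x) (nbhd Q (f x)) f"
proof -
  let ?A = "{p. (x, p) \<in> P} \<union> {p. (p, x) \<in> P}"
  have A: "?A \<subseteq> Field P" by (auto simp: Field_def)
  have "f ` ?A = {p. (f x, p) \<in> Q} \<union> {p. (p, f x) \<in> Q}" (is "_ = ?B")
  proof
    show "f ` ?A \<subseteq> ?B" using A isoD[OF assms(2)] assms(3) by blast
    show "?B \<subseteq> f ` ?A"
    proof
      fix q assume q: "q \<in> ?B"
      then have "q \<in> Field Q" by (auto simp: Field_def)
      then obtain p where "p \<in> Field P" "q = f p" using iso_image[OF assms(2)] by blast
      then show "q \<in> f ` ?A" using q isoD[OF assms(2)] assms(3) by blast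
    qed
  qed
  then show ?thesis
    using iso_Restr[OF assms(1,2) A] by (simp add: nbhd_def)
qed

lemma iso_fin_ordered_set:
  assumes P: "fin_ordered_set P" and f: "iso P Q f"
  shows "fin_ordered_set Q"
proof -
  have Q: "(a, b) \<in> Q \<longleftrightarrow> (\<exists>x y. a = f x \<and> b = f y \<and> (x, y) \<in> P)" for a b
  proof
    assume ab: "(a, b) \<in> Q"
    then have "a \<in> f ` Field P" "b \<in> f ` Field P"
      using iso_image[OF f] by (auto simp: Field_def)
    then show "\<exists>x y. a = f x \<and> b = f y \<and> (x, y) \<in> P"
      using ab isoD[OF f] by blast
  next
    assume "\<exists>x y. a = f x \<and> b = f y \<and> (x, y) \<in> P"
    then show "(a, b) \<in> Q" using isoD[OF f] by (auto intro: FieldI1 FieldI2)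
  qed
  have inj: "x = y" if "f x = f y" "x \<in> Field P" "y \<in> Field P" for x y
    using iso_inj[OF f] that by (auto dest: inj_onD)
  have po: "trans P" "antisym P" "finite (Field P)"
    using P by (auto simp: fin_ordered_set_def order_on_defs)
  have "finite (Field Q)" using po(3) iso_image[OF f] by (metis finite_imageI)
  moreover have "trans Q"
  proof (rule transI)
    fix a b c assume "(a, b) \<in> Q" "(b, c) \<in> Q"
    then obtain x y y' z where *: "a = f x" "b = f y" "b = f y'" "c = f z" "(x, y) \<in> P" "(y', z) \<in> P"
      unfolding Q by blast
    then have "y = y'" by (metis inj FieldI1 FieldI2)
    then show "(a, c) \<in> Q" unfolding Q using * transD[OF po(1)] by blast
  qed
  moreover have "antisym Q"
  proof (rule antisymI)
    fix a b assume "(a, b) \<in> Q" "(b, a) \<in> Q"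
    then obtain x y y' x' where *: "a = f x" "b = f y" "b = f y'" "a = f x'" "(x, y) \<in> P" "(y', x') \<in> P"
      unfolding Q by blast
    then have "y = y'" "x = x'" by (metis inj FieldI1 FieldI2)+
    then show "a = b" using * antisymD[OF po(2)] by blast
  qed
  moreover have "(a, a) \<in> Q" if "a \<in> Field Q" for a
    using that iso_image[OF f] fin_ordered_set_refl[OF P] unfolding Q by blast
  ultimately show ?thesis
    by (auto simp: fin_ordered_set_def order_on_defs refl_on_def Field_def)
qed

lemma iso_the_inv_into:
  assumes f: "iso P Q f"
  shows "iso Q P (the_inv_into (Field P) f)"
proof -
  let ?g = "the_inv_into (Field P) f"
  have b: "bij_betw f (Field P) (Field Q)" using f by (simp add: iso_iff2)
  then have g: "bij_betw ?g (Field Q) (Field P)" by (rule bij_betw_the_inv_into)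
  have "(?g a, ?g b) \<in> P \<longleftrightarrow> (a, b) \<in> Q" if "a \<in> Field Q" "b \<in> Field Q" for a b
    using isoD[OF f, of "?g a" "?g b"] bij_betw_apply[OF g] that
    by (simp add: f_the_inv_into_f_bij_betw[OF b])
  then show ?thesis using g by (simp add: iso_iff2)
qed

lemma iso_comp:
  assumes f: "iso P Q f" and g: "iso Q R g"
  shows "iso P R (g \<circ> f)"
proof -
  have "bij_betw (g \<circ> f) (Field P) (Field R)"
    using f g bij_betw_trans[of f "Field P" "Field Q" g "Field R"] by (simp add: iso_iff2)
  moreover have "(g (f a), g (f b)) \<in> R \<longleftrightarrow> (a, b) \<in> P" if "a \<in> Field P" "b \<in> Field P" for a b
    using isoD[OF f that] isoD[OF g, of "f a" "f b"] iso_image[OF f] that by blast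
  ultimately show ?thesis by (simp add: iso_iff2)
qed

lemma order_isomorphic_sym: "order_isomorphic P Q \<Longrightarrow> order_isomorphic Q P"
  unfolding order_isomorphic_def using iso_the_inv_into by blast

lemma order_isomorphic_trans:
  "order_isomorphic P Q \<Longrightarrow> order_isomorphic Q R \<Longrightarrow> order_isomorphic P R"
  unfolding order_isomorphic_def using iso_comp by blast

section \<open>Rank functions\<close>

text \<open>A certificate that \<open>\<rho>\<close> is the rank: strict monotonicity bounds the
  chains, and descent by exactly one yields a chain of full length.\<close>

definition ranked :: "'a rel \<Rightarrow> ('a \<Rightarrow> nat) \<Rightarrow> bool" where
  "ranked P \<rho> \<longleftrightarrow> (\<forall>x y. (x, y) \<in> P \<longrightarrow> x \<noteq> y \<longrightarrow> \<rho> x < \<rho> y) \<and>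
     (\<forall>x \<in> Field P. 0 < \<rho> x \<longrightarrow> (\<exists>y. (y, x) \<in> P \<and> Suc (\<rho> y) = \<rho> x))"

lemma ranked_chain:
  assumes P: "fin_ordered_set P" and r: "ranked P \<rho>" and x: "x \<in> Field P"
  shows "\<exists>C \<in> chains_to P x. card C = Suc (\<rho> x)"
  using x
proof (induction "\<rho> x" arbitrary: x)
  case 0
  have "(x, x) \<in> P" using fin_ordered_set_refl[OF P 0(2)] .
  moreover have "x \<in> minimals P"
    using r 0 unfolding minimals_def ranked_def by fastforce
  moreover have "linear_order_on {x} (Restr P {x})"
    using \<open>(x, x) \<in> P\<close> by (auto simp: order_on_defs refl_on_def trans_def antisym_def total_on_def)
  ultimately have "{x} \<in> chains_to P x"
    unfolding chains_to_def using 0(2) by auto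
  then show ?case using 0(1) by (intro bexI[of _ "{x}"]) auto
next
  case (Suc k)
  then obtain y where y: "(y, x) \<in> P" "Suc (\<rho> y) = \<rho> x"
    using r unfolding ranked_def by (metis zero_less_Suc)
  then have "k = \<rho> y" "y \<in> Field P" using Suc by (auto intro: FieldI1)
  from Suc(1)[OF this] obtain C where C: "C \<in> chains_to P y" "card C = Suc (\<rho> y)" by blast
  have tr: "trans P" and as: "antisym P"
    using P by (simp_all add: fin_ordered_set_def order_on_defs)
  have xx: "(x, x) \<in> P" using fin_ordered_set_refl[OF P] Suc by blast
  from C(1) have Cs: "C \<subseteq> Field P" "linear_order_on C (Restr P C)" "\<forall>c \<in> C. (c, y) \<in> P" "y \<in> C"
    by (auto simp: chains_to_def)
  obtain a where a: "a \<in> C" "a \<in> minimals P" "\<forall>c \<in> C. (a, c) \<in> P"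
    using C(1) by (auto simp: chains_to_def)
  have cx: "\<forall>c \<in> insert x C. (c, x) \<in> P"
    using Cs(3) y(1) tr xx by (auto dest: transD)
  have "x \<notin> C"
  proof
    assume "x \<in> C"
    then have "(x, y) \<in> P" using Cs by blast
    then have "x = y" using y as by (auto dest: antisymD)
    then show False using y by simp
  qed
  moreover have "finite C"
    using Cs(1) P finite_subset by (auto simp: fin_ordered_set_def)
  ultimately have card: "card (insert x C) = Suc (\<rho> x)" using C(2) y(2) by simp
  have "linear_order_on (insert x C) (Restr P (insert x C))"
    unfolding order_on_defs
  proof (intro conjI)
    show "trans (Restr P (insert x C))" using tr by (rule trans_Restr)
    show "antisym (Restr P (insert x C))" using as by (rule antisym_Restr)
  qed (use Cs(2) cx xx in \<open>auto simp: order_on_defs refl_on_def total_on_def\<close>)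
  moreover have "(a, x) \<in> P" using a(1) cx by blast
  ultimately have "insert x C \<in> chains_to P x"
    unfolding chains_to_def using Cs a cx Suc(3) by blast
  then show ?case using card by blast
qed

lemma order_rank_eqI:
  assumes P: "fin_ordered_set P" and r: "ranked P \<rho>" and x: "x \<in> Field P"
  shows "order_rank P x = \<rho> x"
proof -
  have less: "\<rho> a < \<rho> b" if "(a, b) \<in> P" "a \<noteq> b" for a b
    using r that by (simp add: ranked_def)
  have le: "card C - 1 \<le> \<rho> x" if C: "C \<in> chains_to P x" for C
  proof -
    have tot: "(a, b) \<in> P \<or> (b, a) \<in> P" if "a \<in> C" "b \<in> C" "a \<noteq> b" for a b
      using C that by (auto simp: chains_to_def order_on_defs total_on_def)
    \<comment> \<open>Points of a chain are pairwise comparable, so strict monotonicity gives them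
      distinct values, all at most \<open>\<rho> x\<close>.\<close>
    have "inj_on \<rho> C"
    proof (rule inj_onI, rule ccontr)
      fix a b assume "a \<in> C" "b \<in> C" "\<rho> a = \<rho> b" "a \<noteq> b"
      then show False using tot[of a b] less[of a b] less[of b a] by auto
    qed
    moreover have "\<rho> c \<le> \<rho> x" if "c \<in> C" for c
    proof (cases "c = x")
      case False
      then show ?thesis using C that less[of c x] by (simp add: chains_to_def)
    qed simp
    then have "\<rho> ` C \<subseteq> {..\<rho> x}" by blast
    ultimately have "card C \<le> card {..\<rho> x}" by (rule card_inj_on_le) simp
    then show ?thesis by simp
  qed
  obtain C where C: "C \<in> chains_to P x" "card C = Suc (\<rho> x)"
    using ranked_chain[OF assms] by blast
  then have "\<rho> x \<in> (\<lambda>C. card C - 1) ` chains_to P x" by (intro image_eqI[of _ _ C]) simp_all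
  with finite_chains_to[OF P] le show ?thesis
    unfolding order_rank_def by (intro Max_eqI) auto
qed

section \<open>Transport along isomorphisms\<close>

lemma ranked_iso:
  assumes f: "iso P Q f" and r: "ranked Q \<rho>"
  shows "ranked P (\<rho> \<circ> f)"
  unfolding ranked_def
proof (intro conjI allI impI ballI)
  fix x y assume xy: "(x, y) \<in> P" "x \<noteq> y"
  then have F: "x \<in> Field P" "y \<in> Field P" by (auto intro: FieldI1 FieldI2)
  then have "(f x, f y) \<in> Q" "f x \<noteq> f y"
    using xy isoD[OF f] iso_inj[OF f] by (auto dest: inj_onD)
  then show "(\<rho> \<circ> f) x < (\<rho> \<circ> f) y" using r by (simp add: ranked_def)
next
  fix x assume x: "x \<in> Field P" "0 < (\<rho> \<circ> f) x"
  then have "f x \<in> Field Q" using iso_image[OF f] by blast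
  then obtain q where q: "(q, f x) \<in> Q" "Suc (\<rho> q) = \<rho> (f x)" using r x by (auto simp: ranked_def)
  then obtain y where "y \<in> Field P" "q = f y" using iso_image[OF f] FieldI1[OF q(1)] by blast
  then show "\<exists>y. (y, x) \<in> P \<and> Suc ((\<rho> \<circ> f) y) = (\<rho> \<circ> f) x"
    using q x isoD[OF f] by auto
qed

text \<open>The inverse of \<open>f\<close> carries the rank function to \<open>Q\<close>; both
  ranks are then read off from it rather than from chains.\<close>

lemma order_rank_iso:
  assumes P: "fin_ordered_set P" and f: "iso P Q f" and r: "ranked P \<rho>" and x: "x \<in> Field P"
  shows "order_rank Q (f x) = order_rank P x"
proof -
  let ?g = "the_inv_into (Field P) f"
  have "f x \<in> Field Q" using x iso_image[OF f] by blast
  then have "order_rank Q (f x) = (\<rho> \<circ> ?g) (f x)"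
    by (rule order_rank_eqI[OF iso_fin_ordered_set[OF P f] ranked_iso[OF iso_the_inv_into[OF f] r]])
  also have "\<dots> = \<rho> x" using the_inv_into_f_f[OF iso_inj[OF f] x] by simp
  also have "\<dots> = order_rank P x" using order_rank_eqI[OF P r x] by simp
  finally show ?thesis .
qed

lemma rank_level_iso:
  assumes P: "fin_ordered_set P" and f: "iso P Q f" and r: "ranked P \<rho>"
  shows "rank_level Q k = f ` rank_level P k"
  unfolding rank_level_def iso_image[OF f, symmetric]
  using order_rank_iso[OF P f r] by auto

lemma maximals_iso:
  assumes f: "iso P Q f"
  shows "maximals Q = f ` maximals P"
  unfolding maximals_def iso_image[OF f, symmetric]
  using isoD[OF f] iso_inj[OF f] by (auto simp: inj_on_eq_iff)

lemma minimals_iso: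
  assumes f: "iso P Q f"
  shows "minimals Q = f ` minimals P"
  unfolding minimals_def iso_image[OF f, symmetric]
  using isoD[OF f] iso_inj[OF f] by (auto simp: inj_on_eq_iff)

lemma order_isomorphic_iso:
  assumes "iso P P' f" "iso Q Q' g"
  shows "order_isomorphic P' Q' \<longleftrightarrow> order_isomorphic P Q"
  using assms order_isomorphic_trans order_isomorphic_sym unfolding order_isomorphic_def[of P P']
  by (metis order_isomorphic_def)

lemma matched_image:
  assumes "matched R A B" "inj_on f A" "inj_on g B"
    and R: "\<And>x y. x \<in> A \<Longrightarrow> y \<in> B \<Longrightarrow> R x y \<Longrightarrow> R' (f x) (g y)"
  shows "matched R' (f ` A) (g ` B)"
proof -
  obtain h where h: "bij_betw h A B" "\<forall>x \<in> A. R x (h x)"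
    using assms(1) by (auto simp: matched_def)
  have f: "bij_betw (the_inv_into A f) (f ` A) A" and g: "bij_betw g B (g ` B)"
    using assms(2,3) by (auto intro: bij_betw_the_inv_into inj_on_imp_bij_betw)
  have "bij_betw (g \<circ> h \<circ> the_inv_into A f) (f ` A) (g ` B)"
    using bij_betw_trans[OF f bij_betw_trans[OF h(1) g]] by (simp add: comp_assoc)
  moreover have "R' (f x) ((g \<circ> h \<circ> the_inv_into A f) (f x))" if "x \<in> A" for x
    using that h R bij_betwE[OF h(1)] by (simp add: the_inv_into_f_f[OF assms(2)])
  ultimately show ?thesis unfolding matched_def by blast
qed

lemma ECR_ge:
  assumes "fin_ordered_set P" "A \<subseteq> Field P" "B \<subseteq> Field Q" "matched (cards_iso P Q) A B"
  shows "real (card A) / real (card (Field P)) \<le> ECR P Q"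
proof -
  let ?M = "{card A | A B. A \<subseteq> Field P \<and> B \<subseteq> Field Q \<and> matched (cards_iso P Q) A B}"
  have fin: "finite (Field P)" using assms(1) by (simp add: fin_ordered_set_def)
  have "?M \<subseteq> card ` Pow (Field P)" by blast
  then have "finite ?M" using fin by (meson finite_Pow_iff finite_imageI finite_subset)
  moreover have "card A \<in> ?M" using assms by blast
  ultimately have "card A \<le> Max ?M" by (rule Max_ge)
  then show ?thesis unfolding ECR_def by (intro divide_right_mono) simp_all
qed

context
  fixes P :: "'a rel" and P' :: "'b rel" and Q :: "'c rel" and Q' :: "'d rel" and f g x y
  assumes P: "fin_ordered_set P" and Q: "fin_ordered_set Q"
    and f: "iso P P' f" and g: "iso Q Q' g"
    and x: "x \<in> Field P" and y: "y \<in> Field Q"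
begin

lemma cards_iso_iso: "cards_iso P' Q' (f x) (g y) \<longleftrightarrow> cards_iso P Q x y"
  unfolding cards_iso_def
  by (rule order_isomorphic_iso[OF iso_del_point[OF P f x] iso_del_point[OF Q g y]])

lemma nbhds_iso_iso: "nbhds_iso P' Q' (f x) (g y) \<longleftrightarrow> nbhds_iso P Q x y"
  unfolding nbhds_iso_def
  by (rule order_isomorphic_iso[OF iso_nbhd[OF P f x] iso_nbhd[OF Q g y]])

lemma marked_cards_iso_iso:
  assumes "ranked P \<rho>" "ranked Q \<sigma>" and marked: "marked_cards_iso P Q x y"
  shows "marked_cards_iso P' Q' (f x) (g y)"
proof -
  obtain h where h: "iso (del_point P x) (del_point Q y) h"
    and r: "\<And>z. z \<in> Field P - {x} \<Longrightarrow> order_rank Q (h z) = order_rank P z"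
    using marked by (auto simp: marked_cards_iso_def)
  have FP: "Field (del_point P x) = Field P - {x}" and FQ: "Field (del_point Q y) = Field Q - {y}"
    unfolding del_point_def
    by (rule Field_Restr_refl; use fin_ordered_set_refl[OF P] fin_ordered_set_refl[OF Q] in blast)+
  \<comment> \<open>Conjugation: \<open>?k\<close> returns to the card of \<open>P\<close>, then
    \<open>h\<close> and \<open>g\<close> lead to the card of \<open>Q'\<close>.\<close>
  let ?k = "the_inv_into (Field P - {x}) f"
  have "iso (del_point P' (f x)) (del_point P x) ?k"
    using iso_the_inv_into[OF iso_del_point[OF P f x]] by (simp add: FP)
  then have "iso (del_point P' (f x)) (del_point Q' (g y)) (g \<circ> (h \<circ> ?k))"
    using h iso_del_point[OF Q g y] by (intro iso_comp)
  moreover have "order_rank Q' ((g \<circ> (h \<circ> ?k)) z) = order_rank P' z" if z: "z \<in> Field P' - {f x}" for z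
  proof -
    obtain w where w: "w \<in> Field P - {x}" "z = f w" using z iso_image[OF f] by blast
    have "inj_on f (Field P - {x})" using iso_inj[OF f] by (rule inj_on_subset) blast
    then have "?k z = w" using w the_inv_into_f_f by fastforce
    moreover have "h w \<in> Field Q" using w(1) iso_image[OF h] FP FQ by blast
    ultimately show ?thesis
      using w r[OF w(1)] order_rank_iso[OF Q g assms(2), of "h w"] order_rank_iso[OF P f assms(1), of w]
      by simp
  qed
  ultimately show ?thesis unfolding marked_cards_iso_def by blast
qed

end

section \<open>The cyclic construction\<close>

datatype pt = Link nat | Pair nat bool | Gate nat bool bool

instance pt :: countable by countable_datatype

text \<open>\<open>S\<close> is the number of links of each rank and \<open>K\<close> the greatest
  rank. Four indices per rank leave room to avoid given fibres, and \<open>K\<close> of at least 4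
  exceeds the rank of every gate.\<close>

locale cyclic =
  fixes S K :: nat
  assumes S: "4 \<le> S" and K: "4 \<le> K"
begin

definition m :: nat where "m = S * Suc K"

definition nxt :: "nat \<Rightarrow> nat" where "nxt i = (if Suc i = m then 0 else Suc i)"

text \<open>The indices fall into blocks of \<open>S\<close> consecutive ones; the number of the
  block becomes the rank of its links.\<close>

definition \<rho> :: "nat \<Rightarrow> nat" where "\<rho> i = i div S"

text \<open>The rank of the gates at \<open>i\<close>. It is one above the pairs, except that the
  links of rank 2 lie below gates of their own block and push these to rank 3.\<close>

definition \<beta> :: "nat \<Rightarrow> nat" where "\<beta> i = (if \<rho> i = 2 then 3 else 2)"

text \<open>The gates \<open>Gate i u v\<close> lie above \<open>Pair i u\<close> and \<open>Pair (nxt i) v\<close>. Links of rank at most 2 lie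
  below gates and those of rank at least 3 above them; \<open>t i\<close> says whether the matching at \<open>i\<close> is
  twisted.\<close>

fun less :: "(nat \<Rightarrow> bool) \<Rightarrow> pt \<Rightarrow> pt \<Rightarrow> bool" where
  "less t (Link i) (Link j) \<longleftrightarrow> \<rho> i < \<rho> j"
| "less t (Link i) (Pair j w) \<longleftrightarrow> \<rho> i = 0 \<and> j \<noteq> i \<and> j \<noteq> nxt i"
| "less t (Link i) (Gate j u v) \<longleftrightarrow>
     \<rho> i \<le> 2 \<and> \<rho> i \<le> \<rho> j \<and> \<rho> i < \<beta> j \<and> (i = j \<longrightarrow> (u \<noteq> v) = t i)"
| "less t (Pair j w) (Link i) \<longleftrightarrow> 3 \<le> \<rho> i"
| "less t (Pair j w) (Gate i u v) \<longleftrightarrow> j = i \<and> w = u \<or> j = nxt i \<and> w = v"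
| "less t (Gate j u v) (Link i) \<longleftrightarrow>
     3 \<le> \<rho> i \<and> \<rho> j \<le> \<rho> i \<and> \<beta> j < \<rho> i \<and> (i = j \<longrightarrow> (u \<noteq> v) = t i)"
| "less t _ _ \<longleftrightarrow> False"

fun idx :: "pt \<Rightarrow> nat" where
  "idx (Link i) = i" | "idx (Pair i w) = i" | "idx (Gate i u v) = i"

fun rk :: "pt \<Rightarrow> nat" where
  "rk (Link i) = \<rho> i" | "rk (Pair i w) = 1" | "rk (Gate i u v) = \<beta> i"

definition pts :: "pt set" where "pts = {x. idx x < m}"

definition Ord :: "(nat \<Rightarrow> bool) \<Rightarrow> pt rel" where
  "Ord t = {(x, y). x \<in> pts \<and> y \<in> pts \<and> (x = y \<or> less t x y)}"

section \<open>The order and its ranks\<close>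

lemma less_rk: "less t x y \<Longrightarrow> rk x < rk y"
  by (cases "(t, x, y)" rule: less.cases) (auto simp: \<beta>_def split: if_splits)

text \<open>The side conditions of \<open>less\<close> prevent a composite comparison from linking
  \<open>Link i\<close> to an unselected gate at \<open>i\<close>. Links between
  \<open>Link i\<close> and a gate at \<open>i\<close> are excluded by comparing blocks, and pairs
  between them by \<open>j \<noteq> i\<close> and \<open>j \<noteq> nxt i\<close>.\<close>

lemma less_trans: "less t x y \<Longrightarrow> less t y z \<Longrightarrow> less t x z"
  by (cases x; cases y; cases z) (auto simp: \<beta>_def split: if_splits)

lemma Ord_iff: "(x, y) \<in> Ord t \<longleftrightarrow> x \<in> pts \<and> y \<in> pts \<and> (x = y \<or> less t x y)"
  by (simp add: Ord_def)

lemma Field_Ord [simp]: "Field (Ord t) = pts"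
  by (auto simp: Field_def Ord_iff)

lemma pts_eq:
  "pts = (\<Union>i<m. {Link i, Pair i False, Pair i True, Gate i False False, Gate i False True,
     Gate i True False, Gate i True True})" (is "_ = ?R")
proof (rule set_eqI)
  fix x show "x \<in> pts \<longleftrightarrow> x \<in> ?R" by (cases x) (auto simp: pts_def)
qed

lemma finite_pts: "finite pts"
  by (simp add: pts_eq)

lemma card_pts: "card pts \<le> 7 * m"
  unfolding pts_eq by (rule order.trans[OF card_UN_le]) simp_all

lemma fin_Ord: "fin_ordered_set (Ord t)"
proof -
  have "trans (Ord t)" by (auto simp: trans_def Ord_iff intro: less_trans)
  moreover have "antisym (Ord t)"
    by (auto simp: antisym_def Ord_iff dest!: less_rk)
  moreover have "refl_on pts (Ord t)" "Ord t \<subseteq> pts \<times> pts"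
    by (auto simp: refl_on_def Ord_iff)
  ultimately show ?thesis
    using finite_pts by (simp add: fin_ordered_set_def order_on_defs)
qed

lemma index_less: "r \<le> K \<Longrightarrow> a < S \<Longrightarrow> r * S + a < m"
proof -
  assume "r \<le> K" "a < S"
  then have "r * S + a < Suc r * S" by simp
  also have "\<dots> \<le> Suc K * S" using \<open>r \<le> K\<close> by (intro mult_le_mono1) simp
  finally show ?thesis by (simp add: m_def mult.commute)
qed

lemma \<rho>_index: "a < S \<Longrightarrow> \<rho> (r * S + a) = r"
  using S by (simp add: \<rho>_def)

lemma \<rho>_le: "i < m \<Longrightarrow> \<rho> i \<le> K"
  using S unfolding \<rho>_def m_def by (metis less_Suc_eq_le less_mult_imp_div_less mult.commute)

lemma nxt_less: "i < m \<Longrightarrow> nxt i < m"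
  by (auto simp: nxt_def)

lemma m_ge: "4 \<le> m"
  using S unfolding m_def by (metis le_trans mult_le_mono mult.right_neutral One_nat_def Suc_le_mono le0)

lemma nxt_neq [simp]: "nxt i \<noteq> i" "i \<noteq> nxt i"
  using m_ge by (auto simp: nxt_def)

text \<open>Among three consecutive indices of a block, each of the two exclusions rules out at most
  one.\<close>

lemma ex_index:
  assumes "r \<le> K"
  obtains i where "i < m" "\<rho> i = r" "i \<noteq> a" "nxt i \<noteq> b"
proof -
  \<comment> \<open>Since \<open>S\<close> is at least 4, the successor is still in the block for
    \<open>c < 3\<close>, so \<open>nxt\<close> does not wrap around.\<close>
  have *: "r * S + c < m \<and> \<rho> (r * S + c) = r \<and> nxt (r * S + c) = Suc (r * S + c)" if "c < 3" for c
    using index_less[OF assms, of c] index_less[OF assms, of "Suc c"] \<rho>_index[of c r] that S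
    by (auto simp: nxt_def)
  have "\<exists>c<3. r * S + c \<noteq> a \<and> Suc (r * S + c) \<noteq> b"
  proof (rule ccontr)
    assume "\<not> ?thesis"
    then have "r * S + c = a \<or> Suc (r * S + c) = b" if "c < 3" for c using that by blast
    from this[of 0] this[of 1] this[of 2] show False by auto
  qed
  then show ?thesis using * that by metis
qed

text \<open>Witnesses one rank lower: a link for a link, a rank 0 link away from the fibre for a
  pair, and for a gate a pair below it or, in block 2, another link of that block.\<close>

lemma ranked_Ord: "ranked (Ord t) rk"
  unfolding ranked_def
proof (intro conjI allI impI ballI)
  fix x y assume "(x, y) \<in> Ord t" "x \<noteq> y"
  then show "rk x < rk y" by (auto simp: Ord_iff intro: less_rk)
next
  fix x assume x: "x \<in> Field (Ord t)" "0 < rk x"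
  then have xp: "x \<in> pts" by simp
  have "\<exists>y \<in> pts. less t y x \<and> Suc (rk y) = rk x"
  proof (cases x)
    case (Link i)
    then have "\<rho> i - 1 \<le> K" using xp \<rho>_le[of i] by (simp add: pts_def)
    then obtain j where "j < m" "\<rho> j = \<rho> i - 1" using ex_index[of _ 0 0] by blast
    then show ?thesis using Link x by (intro bexI[of _ "Link j"]) (auto simp: pts_def)
  next
    case (Pair i w)
    obtain j where "j < m" "\<rho> j = 0" "j \<noteq> i" "nxt j \<noteq> i" using ex_index[of 0 i i] by blast
    then show ?thesis using Pair by (intro bexI[of _ "Link j"]) (auto simp: pts_def)
  next
    case (Gate i u v)
    show ?thesis
    proof (cases "\<rho> i = 2")
      case True
      obtain j where "j < m" "\<rho> j = 2" "j \<noteq> i" using ex_index[of 2 i i] K by auto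
      then show ?thesis using Gate True
        by (intro bexI[of _ "Link j"]) (auto simp: pts_def \<beta>_def)
    next
      case False
      then show ?thesis using Gate xp
        by (intro bexI[of _ "Pair i u"]) (auto simp: pts_def \<beta>_def)
    qed
  qed
  then show "\<exists>y. (y, x) \<in> Ord t \<and> Suc (rk y) = rk x"
    using xp by (auto simp: Ord_iff)
qed

lemma order_rank_Ord [simp]: "x \<in> pts \<Longrightarrow> order_rank (Ord t) x = rk x"
  using order_rank_eqI[OF fin_Ord ranked_Ord] by simp

lemma rank_level_Ord: "rank_level (Ord t) k = {x \<in> pts. rk x = k}"
  by (auto simp: rank_level_def)

section \<open>Links and extremal points\<close>

definition links :: "nat \<Rightarrow> pt set" where
  "links r = Link ` {i. i < m \<and> \<rho> i = r}"

lemma links_pts: "links r \<subseteq> pts"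
  by (auto simp: links_def pts_def)

lemma card_links: "r \<le> K \<Longrightarrow> S \<le> card (links r)"
proof -
  assume r: "r \<le> K"
  have "(\<lambda>a. Link (r * S + a)) ` {..<S} \<subseteq> links r"
    using index_less[OF r] \<rho>_index by (auto simp: links_def)
  moreover have "finite (links r)" using links_pts finite_pts finite_subset by blast
  moreover have "inj_on (\<lambda>a. Link (r * S + a)) {..<S}" by (auto simp: inj_on_def)
  ultimately show ?thesis by (metis card_image card_lessThan card_mono)
qed

lemma links_nonempty: "r \<le> K \<Longrightarrow> links r \<noteq> {}"
  using card_links[of r] S by auto

text \<open>Pairs have rank 1 and gates rank 2 or 3, so the remaining ranks consist of links alone.
  The special ranks are taken from these.\<close>

lemma rank_level_links:
  assumes "k = 0 \<or> 4 \<le> k"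
  shows "rank_level (Ord t) k = links k"
proof -
  have "x \<in> pts \<and> rk x = k \<longleftrightarrow> x \<in> links k" for x
    using assms by (cases x) (auto simp: links_def pts_def \<beta>_def)
  then show ?thesis by (auto simp: rank_level_Ord)
qed

text \<open>A top link at another index lies above \<open>x\<close>, since the twist condition
  concerns only equal indices.\<close>

lemma ex_above:
  assumes x: "x \<in> pts" "rk x < K \<or> (\<forall>i. x \<noteq> Link i)"
  shows "\<exists>y \<in> pts. less t x y"
proof -
  obtain i where i: "i < m" "\<rho> i = K" "i \<noteq> idx x" using ex_index[of K "idx x" 0] by auto
  then have "less t x (Link i)"
    using assms K \<rho>_le[of "idx x"] by (cases x) (auto simp: \<beta>_def pts_def)
  then show ?thesis using i by (intro bexI[of _ "Link i"]) (auto simp: pts_def)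
qed

lemma maximals_Ord: "maximals (Ord t) = links K"
proof -
  have "x \<in> maximals (Ord t) \<longleftrightarrow> x \<in> links K" for x
  proof
    assume x: "x \<in> maximals (Ord t)"
    then have xp: "x \<in> pts" by (simp add: maximals_def)
    have "y = x" if "y \<in> pts" "less t x y" for y
      using x that xp by (auto simp: maximals_def Ord_iff)
    then have "\<not> (\<exists>y \<in> pts. less t x y)" by (metis less_rk less_irrefl)
    then have "\<not> (rk x < K \<or> (\<forall>i. x \<noteq> Link i))" using ex_above[OF xp] by blast
    then obtain i where "x = Link i" "K \<le> \<rho> i" by auto
    then show "x \<in> links K" using xp \<rho>_le[of i] by (auto simp: links_def pts_def)
  next
    assume "x \<in> links K"
    then obtain i where i: "x = Link i" "i < m" "\<rho> i = K" by (auto simp: links_def)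
    have "\<not> less t x y" if "y \<in> pts" for y
      using that i \<rho>_le[of "idx y"] K by (cases y) (auto simp: pts_def)
    then show "x \<in> maximals (Ord t)" using i by (auto simp: maximals_def Ord_iff pts_def)
  qed
  then show ?thesis by blast
qed

lemma minimals_Ord: "minimals (Ord t) = links 0"
proof -
  have "x \<in> minimals (Ord t) \<longleftrightarrow> x \<in> pts \<and> rk x = 0" for x
  proof
    assume x: "x \<in> minimals (Ord t)"
    then have xp: "x \<in> Field (Ord t)" by (simp add: minimals_def)
    have "rk x = 0"
    proof (rule ccontr)
      assume "rk x \<noteq> 0"
      then obtain y where y: "(y, x) \<in> Ord t" "Suc (rk y) = rk x"
        using ranked_Ord[of t] xp unfolding ranked_def by blast
      then have "y = x" using x FieldI1[OF y(1)] by (auto simp: minimals_def)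
      then show False using y by simp
    qed
    then show "x \<in> pts \<and> rk x = 0" using xp by simp
  next
    assume "x \<in> pts \<and> rk x = 0"
    then show "x \<in> minimals (Ord t)" by (auto simp: minimals_def Ord_iff dest!: less_rk)
  qed
  then show ?thesis using rank_level_links[of 0 t] by (auto simp: rank_level_Ord)
qed

section \<open>Switching fibres and hiding the twist\<close>

text \<open>Swaps the two points of each fibre chosen by \<open>s\<close>; gates follow their pair
  points and links stay fixed.\<close>

fun switch :: "(nat \<Rightarrow> bool) \<Rightarrow> pt \<Rightarrow> pt" where
  "switch s (Link i) = Link i"
| "switch s (Pair j w) = Pair j (w \<noteq> s j)"
| "switch s (Gate i u v) = Gate i (u \<noteq> s i) (v \<noteq> s (nxt i))"

lemma switch_switch [simp]: "switch s (switch s x) = x"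
  by (cases x) auto

lemma idx_switch [simp]: "idx (switch s x) = idx x"
  by (cases x) auto

lemma rk_switch [simp]: "rk (switch s x) = rk x"
  by (cases x) auto

lemma switch_pts [simp]: "switch s x \<in> pts \<longleftrightarrow> x \<in> pts"
  by (simp add: pts_def)

lemma switch_eq_iff [simp]: "switch s x = switch s y \<longleftrightarrow> x = y"
  by (metis switch_switch)

text \<open>Swapping one fibre exchanges the straight and the twisted matching at both indices that
  meet it, so \<open>t\<close> changes by the differences of \<open>s\<close> around the
  cycle.\<close>

lemma less_switch:
  assumes "x \<in> pts" "y \<in> pts" "\<And>i. i < m \<Longrightarrow> t' i = (t i \<noteq> (s i \<noteq> s (nxt i)))"
  shows "less t' (switch s x) (switch s y) \<longleftrightarrow> less t x y"
  using assms by (cases x; cases y) (auto simp: pts_def)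

lemma iso_switch:
  assumes "\<And>i. i < m \<Longrightarrow> t' i = (t i \<noteq> (s i \<noteq> s (nxt i)))"
  shows "iso (Ord t) (Ord t') (switch s)"
proof -
  have "bij_betw (switch s) pts pts"
    by (rule bij_betw_byWitness[where f' = "switch s"]) auto
  then show ?thesis
    using less_switch[where t = t and t' = t' and s = s, OF _ _ assms] by (auto simp: iso_iff2 Ord_iff)
qed

definition move :: "nat \<Rightarrow> pt \<Rightarrow> pt" where
  "move k = switch (\<lambda>i. 0 < i \<and> i \<le> k)"

text \<open>Swapping the fibres 1 to \<open>k\<close> affects only the matchings at the two ends of
  this run, at 0 and at \<open>k\<close>, and so carries the twist from \<open>k\<close> to
  0.\<close>

lemma iso_move: "k < m \<Longrightarrow> iso (Ord (\<lambda>i. i = k)) (Ord (\<lambda>i. i = 0)) (move k)"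
  unfolding move_def by (rule iso_switch) (auto simp: nxt_def)

abbreviation Q1 :: "pt rel" where "Q1 \<equiv> Ord (\<lambda>i. False)"
abbreviation Q2 :: "pt rel" where "Q2 \<equiv> Ord (\<lambda>i. i = 0)"

text \<open>The twist at \<open>k\<close> enters only comparisons with
  \<open>Link k\<close>.\<close>

lemma less_untwist:
  "x \<noteq> Link k \<Longrightarrow> y \<noteq> Link k \<Longrightarrow> less (\<lambda>i. i = k) x y \<longleftrightarrow> less (\<lambda>i. False) x y"
  by (cases x; cases y) auto

lemma del_untwist: "del_point (Ord (\<lambda>i. i = k)) (Link k) = del_point Q1 (Link k)"
  by (auto simp: del_point_def Ord_iff less_untwist)

text \<open>Once \<open>Link i\<close> is deleted, a twist at \<open>i\<close> is invisible;
  \<open>move i\<close> carries it to 0, fixing links and preserving ranks.\<close>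

lemma marked_links:
  assumes "i < m"
  shows "marked_cards_iso Q1 Q2 (Link i) (Link i)" "cards_iso Q1 Q2 (Link i) (Link i)"
proof -
  have "iso (del_point Q1 (Link i)) (del_point Q2 (Link i)) (move i)"
    using iso_del_point[OF fin_Ord iso_move[OF assms], of "Link i"] assms
    by (simp add: del_untwist pts_def move_def)
  moreover have "\<forall>z \<in> Field Q1 - {Link i}. order_rank Q2 (move i z) = order_rank Q1 z"
    by (simp add: move_def)
  ultimately show "marked_cards_iso Q1 Q2 (Link i) (Link i)" "cards_iso Q1 Q2 (Link i) (Link i)"
    unfolding marked_cards_iso_def cards_iso_def order_isomorphic_def by blast+
qed

text \<open>The link \<open>Link (far x)\<close> is incomparable to \<open>x\<close>, so the twist can be hidden there from the
  neighborhood of \<open>x\<close>; it depends only on the fibre of \<open>x\<close>, so that \<open>\<lambda>x. move (far x) x\<close> is an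
  involution.\<close>

fun far :: "pt \<Rightarrow> nat" where
  "far (Link i) = (SOME k. k < m \<and> \<rho> k = \<rho> i \<and> k \<noteq> i)"
| "far (Pair j w) = S"
| "far (Gate j u v) = (if \<rho> j = 0 then S else if \<rho> j = 2 then 3 * S else 2 * S)"

text \<open>Links and pairs are incomparable to links of their own rank. A gate of block 0 is too
  low in the blocks for a link of rank 1; any other gate gets a link of its own rank.\<close>

lemma far_less:
  assumes "x \<in> pts"
  shows "far x < m" and "Link (far x) \<noteq> x"
    and "\<not> less t x (Link (far x))" and "\<not> less t (Link (far x)) x"
proof -
  \<comment> \<open>\<open>S\<close>, \<open>2 * S\<close> and \<open>3 * S\<close> are the first
    indices of the blocks 1, 2 and 3.\<close>
  have 1: "S < m" "2 * S < m" "3 * S < m" "\<rho> S = 1" "\<rho> (2 * S) = 2" "\<rho> (3 * S) = 3"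
    using index_less[of 1 0] index_less[of 2 0] index_less[of 3 0] S K
    by (auto simp: \<rho>_def)
  have 2: "far (Link i) < m \<and> \<rho> (far (Link i)) = \<rho> i \<and> far (Link i) \<noteq> i" if "i < m" for i
    unfolding far.simps by (rule someI_ex) (metis ex_index \<rho>_le that)
  show "far x < m" using 1 2 assms by (cases x) (auto simp: pts_def simp del: far.simps(1))
  show "Link (far x) \<noteq> x"
    using 1 2 assms by (cases x) (auto simp: pts_def simp del: far.simps(1))
  show "\<not> less t x (Link (far x))" "\<not> less t (Link (far x)) x"
    using 1 2 assms by (cases x; auto simp: pts_def \<beta>_def simp del: far.simps(1))+
qed

lemma far_switch [simp]: "far (switch s x) = far x"
  by (cases x) auto

text \<open>The only link that shows the twist is neither \<open>x\<close> nor comparable to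
  \<open>x\<close>.\<close>

lemma nbhd_untwist:
  assumes "x \<in> pts"
  shows "nbhd (Ord (\<lambda>i. i = far x)) x = nbhd Q1 x"
proof -
  note far = far_less[OF assms]
  let ?k = "far x"
  have l: "less (\<lambda>i. i = ?k) x y \<longleftrightarrow> less (\<lambda>i. False) x y"
    "less (\<lambda>i. i = ?k) y x \<longleftrightarrow> less (\<lambda>i. False) y x" for y
    using far less_untwist[of x ?k y] less_untwist[of y ?k x] by metis+
  have n: "y \<noteq> Link ?k" if "x = y \<or> less (\<lambda>i. False) x y \<or> less (\<lambda>i. False) y x" for y
    using that far by metis
  show ?thesis
    by (auto simp: nbhd_def Ord_iff l less_untwist n)
qed

lemma nbhds_move:
  assumes "x \<in> pts"
  shows "nbhds_iso Q1 Q2 x (move (far x) x)"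
  using iso_nbhd[OF fin_Ord iso_move[OF far_less(1)[OF assms]], of x] assms
  unfolding nbhds_iso_def order_isomorphic_def by (auto simp: nbhd_untwist)

lemma nbhds_links: "i < m \<Longrightarrow> nbhds_iso Q1 Q2 (Link i) (Link i)"
  using nbhds_move[of "Link i"] by (simp add: pts_def move_def)

text \<open>The isomorphism varies with \<open>x\<close>, yet \<open>move (far x) x\<close> is a
  bijection: it preserves rank and \<open>far\<close>, hence is its own inverse.\<close>

lemma matched_nbhds: "matched (nbhds_iso Q1 Q2) (rank_level Q1 k) (rank_level Q2 k)"
  unfolding matched_def rank_level_Ord
proof (intro exI[of _ "\<lambda>x. move (far x) x"] conjI ballI)
  show "bij_betw (\<lambda>x. move (far x) x) {x \<in> pts. rk x = k} {x \<in> pts. rk x = k}"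
    by (rule bij_betw_byWitness[where f' = "\<lambda>x. move (far x) x"]) (auto simp: move_def)
qed (simp add: nbhds_move)

lemma link_rank:
  assumes "x \<in> pts"
  obtains i where "i < m" "\<rho> i = rk x"
proof -
  have "rk x \<le> K" using assms K \<rho>_le by (cases x) (auto simp: pts_def \<beta>_def)
  then show ?thesis using ex_index[of "rk x" 0 0] that by blast
qed

section \<open>Recognizing pairs and balanced gates from the order\<close>

definition is_pair :: "pt \<Rightarrow> bool" where "is_pair x \<longleftrightarrow> (\<exists>j w. x = Pair j w)"
definition is_gate :: "pt \<Rightarrow> bool" where "is_gate x \<longleftrightarrow> (\<exists>j u v. x = Gate j u v)"

text \<open>These are the gates selected by their own link, that is, comparable to it.\<close>

definition balanced :: "(nat \<Rightarrow> bool) \<Rightarrow> pt \<Rightarrow> bool" where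
  "balanced t x \<longleftrightarrow> (\<exists>j u v. x = Gate j u v \<and> (u \<noteq> v) = t j)"

text \<open>A link of rank 1 lies below everything of rank 3, while a pair point misses the rank 3
  gates away from its fibre. Only rank and order occur on the right, so isomorphisms preserve the
  property.\<close>

lemma is_pair_iff:
  assumes "x \<in> pts"
  shows "is_pair x \<longleftrightarrow> rk x = 1 \<and> (\<exists>y \<in> pts. rk y = 3 \<and> \<not> less t x y)"
proof (cases x)
  case (Link i)
  have "less t x y" if "\<rho> i = 1" "rk y = 3" for y
    using that Link by (cases y) (auto simp: \<beta>_def split: if_splits)
  then show ?thesis using Link by (auto simp: is_pair_def)
next
  case (Pair j w)
  obtain l where "l < m" "\<rho> l = 2" "l \<noteq> j" "nxt l \<noteq> j" using ex_index[of 2 j j] K by auto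
  then have "\<exists>y \<in> pts. rk y = 3 \<and> \<not> less t x y"
    using Pair by (intro bexI[of _ "Gate l w w"]) (auto simp: pts_def \<beta>_def)
  then show ?thesis using Pair unfolding is_pair_def by auto
next
  case (Gate i u v)
  then show ?thesis by (auto simp: is_pair_def \<beta>_def)
qed

text \<open>The competitors are links: those of rank 2 lie above no pair point, those of rank 3
  above all of them.\<close>

lemma is_gate_iff:
  assumes "x \<in> pts"
  shows "is_gate x \<longleftrightarrow> rk x \<in> {2, 3} \<and> (\<exists>c \<in> pts. is_pair c \<and> less t c x) \<and>
    (\<exists>c \<in> pts. is_pair c \<and> \<not> less t c x)"
proof (cases x)
  case (Link i)
  then show ?thesis by (auto simp: is_pair_def is_gate_def)
next
  case (Pair j w)
  then show ?thesis by (auto simp: is_gate_def)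
next
  case (Gate i u v)
  have "\<exists>c \<in> pts. is_pair c \<and> less t c x"
    using Gate assms by (intro bexI[of _ "Pair i u"]) (auto simp: pts_def is_pair_def)
  moreover have "\<exists>c \<in> pts. is_pair c \<and> \<not> less t c x"
    using Gate assms by (intro bexI[of _ "Pair i (\<not> u)"]) (auto simp: pts_def is_pair_def)
  moreover have "is_gate x" "rk x \<in> {2, 3}" using Gate by (auto simp: is_gate_def \<beta>_def)
  ultimately show ?thesis by blast
qed

text \<open>For points \<open>p\<close> and \<open>q\<close> of the order: two links of equal rank
  of which \<open>x\<close> is comparable to \<open>p\<close> only. Links are described as neither
  pairs nor gates, which isomorphisms preserve.\<close>

definition skew :: "(nat \<Rightarrow> bool) \<Rightarrow> pt \<Rightarrow> pt \<Rightarrow> pt \<Rightarrow> bool" where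
  "skew t x p q \<longleftrightarrow> \<not> is_pair p \<and> \<not> is_gate p \<and> \<not> is_pair q \<and> \<not> is_gate q \<and> rk p = rk q \<and>
     (less t p x \<or> less t x p) \<and> \<not> (less t q x \<or> less t x q)"

text \<open>An unbalanced gate is comparable to all links of the rank of its own link, except its own.\<close>

lemma balanced_iff:
  assumes "x \<in> pts"
  shows "balanced t x \<longleftrightarrow> is_gate x \<and> (\<forall>p \<in> pts. \<forall>q \<in> pts. \<not> skew t x p q)"
proof (cases x)
  case (Gate i u v)
  show ?thesis
  proof (cases "(u \<noteq> v) = t i")
    case True
    have "\<not> skew t x p q" for p q
      using Gate True by (cases p; cases q) (auto simp: skew_def is_pair_def is_gate_def)
    then show ?thesis using Gate True by (auto simp: balanced_def is_gate_def)
  next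
    case False
    have i: "i < m" using Gate assms by (simp add: pts_def)
    obtain l where l: "l < m" "\<rho> l = \<rho> i" "l \<noteq> i" using ex_index[OF \<rho>_le[OF i], of i i] by blast
    have "skew t x (Link l) (Link i)"
      using Gate False l by (auto simp: skew_def is_pair_def is_gate_def \<beta>_def)
    moreover have "Link l \<in> pts" "Link i \<in> pts" using l i by (auto simp: pts_def)
    ultimately show ?thesis using Gate False by (auto simp: balanced_def)
  qed
qed (auto simp: balanced_def is_gate_def)

text \<open>The balanced gates join the pair points into two cycles of length \<open>m\<close> for the untwisted
  order, and into one of length \<open>2 * m\<close> for the twisted one.\<close>

definition joined :: "(nat \<Rightarrow> bool) \<Rightarrow> pt \<Rightarrow> pt \<Rightarrow> bool" where
  "joined t c d \<longleftrightarrow> c \<in> pts \<and> d \<in> pts \<and> is_pair c \<and> is_pair d \<and>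
     (\<exists>b \<in> pts. balanced t b \<and> less t c b \<and> less t d b)"

context
  fixes t t' :: "nat \<Rightarrow> bool" and f :: "pt \<Rightarrow> pt"
  assumes f: "iso (Ord t) (Ord t') f"
begin

lemma f_image: "f ` pts = pts"
  using iso_image[OF f] by simp

lemma f_pts: "x \<in> pts \<Longrightarrow> f x \<in> pts"
  using f_image by blast

lemma f_less:
  assumes "x \<in> pts" "y \<in> pts"
  shows "less t' (f x) (f y) \<longleftrightarrow> less t x y"
proof (cases "x = y")
  case True
  then show ?thesis using less_rk[of t x x] less_rk[of t' "f x" "f x"] by blast
next
  case False
  then have "f x \<noteq> f y" using iso_inj[OF f] assms by (auto dest: inj_onD)
  then show ?thesis using False isoD[OF f, of x y] assms f_pts by (simp add: Ord_iff)
qed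

lemma f_rk: "x \<in> pts \<Longrightarrow> rk (f x) = rk x"
  using order_rank_iso[OF fin_Ord f ranked_Ord, of x] by (simp add: f_pts)

lemma ball_f: "(\<forall>y \<in> pts. R y) \<longleftrightarrow> (\<forall>x \<in> pts. R (f x))"
  by (subst f_image[symmetric]) simp

lemma bex_f: "(\<exists>y \<in> pts. R y) \<longleftrightarrow> (\<exists>x \<in> pts. R (f x))"
  by (subst f_image[symmetric]) simp

text \<open>From here to \<open>f_joined\<close>, each notion is described by order, rank and the
  notions before it, so an isomorphism preserves it in turn.\<close>

lemma f_pair:
  assumes x: "x \<in> pts"
  shows "is_pair (f x) \<longleftrightarrow> is_pair x"
  unfolding is_pair_iff[OF f_pts[OF x], of t'] is_pair_iff[OF x, of t]
    bex_f[of "\<lambda>y. rk y = 3 \<and> \<not> less t' (f x) y"]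
  using x by (simp add: f_rk f_less cong: bex_cong)

lemma f_gate:
  assumes x: "x \<in> pts"
  shows "is_gate (f x) \<longleftrightarrow> is_gate x"
  unfolding is_gate_iff[OF f_pts[OF x], of t'] is_gate_iff[OF x, of t]
    bex_f[of "\<lambda>c. is_pair c \<and> less t' c (f x)"] bex_f[of "\<lambda>c. is_pair c \<and> \<not> less t' c (f x)"]
  using x by (simp add: f_rk f_less f_pair cong: bex_cong)

lemma f_balanced:
  assumes x: "x \<in> pts"
  shows "balanced t' (f x) \<longleftrightarrow> balanced t x"
proof -
  have "skew t' (f x) (f p) (f q) \<longleftrightarrow> skew t x p q" if "p \<in> pts" "q \<in> pts" for p q
    using that x by (simp add: skew_def f_pair f_gate f_rk f_less)
  then show ?thesis
    unfolding balanced_iff[OF f_pts[OF x]] balanced_iff[OF x]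
      ball_f[of "\<lambda>p. \<forall>q \<in> pts. \<not> skew t' (f x) p q"] ball_f[of "\<lambda>q. \<not> skew t' (f x) (f p) q" for p]
    using x by (simp add: f_gate cong: ball_cong)
qed

lemma f_joined:
  assumes "c \<in> pts" "d \<in> pts"
  shows "joined t' (f c) (f d) \<longleftrightarrow> joined t c d"
  unfolding joined_def bex_f[of "\<lambda>b. balanced t' b \<and> less t' (f c) b \<and> less t' (f d) b"]
  using assms by (simp add: f_pts f_pair f_balanced f_less cong: bex_cong)

end

section \<open>Cycles of balanced gates and non-isomorphism\<close>

lemma joined_nxt:
  assumes i: "i < m" and uv: "(u \<noteq> v) = t i"
  shows "joined t (Pair i u) (Pair (nxt i) v)" "joined t (Pair (nxt i) v) (Pair i u)"
proof -
  have "Gate i u v \<in> pts" "Pair i u \<in> pts" "Pair (nxt i) v \<in> pts"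
    using i nxt_less by (simp_all add: pts_def)
  moreover have "balanced t (Gate i u v)" using uv by (simp add: balanced_def)
  moreover have "less t (Pair i u) (Gate i u v)" "less t (Pair (nxt i) v) (Gate i u v)" by auto
  moreover have "is_pair (Pair i u)" "is_pair (Pair (nxt i) v)" by (auto simp: is_pair_def)
  ultimately show "joined t (Pair i u) (Pair (nxt i) v)" "joined t (Pair (nxt i) v) (Pair i u)"
    unfolding joined_def by blast+
qed

text \<open>One tour of the cycle crosses the twisted matching exactly once and so leads from one
  point of a fibre to the other.\<close>

lemma twisted_connected:
  assumes closed: "\<And>c d. c \<in> Y \<Longrightarrow> joined (\<lambda>i. i = 0) c d \<Longrightarrow> d \<in> Y"
    and start: "Pair i w \<in> Y" "i < m" and j: "j < m"
  shows "Pair j w' \<in> Y"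
proof -
  have m: "1 < m" using m_ge by simp
  have fwd: "Pair (nxt i) v \<in> Y" if "Pair i u \<in> Y" "i < m" "(u \<noteq> v) = (i = 0)" for i u v
    by (rule closed[OF that(1) joined_nxt(1)[where t = "\<lambda>i. i = 0", OF that(2,3)]])
  have bwd: "Pair i u \<in> Y" if "Pair (nxt i) v \<in> Y" "i < m" "(u \<noteq> v) = (i = 0)" for i u v
    by (rule closed[OF that(1) joined_nxt(2)[where t = "\<lambda>i. i = 0", OF that(2,3)]])
  have nxt: "nxt k = Suc k" if "Suc k < m" for k using that by (simp add: nxt_def)
  \<comment> \<open>Walk backwards to fibre 0; the point flips only when the matching at 0 is
    crossed.\<close>
  have "\<exists>w. Pair 0 w \<in> Y" using start
  proof (induction i arbitrary: w)
    case (Suc i)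
    have "Pair i (w \<noteq> (i = 0)) \<in> Y"
      by (rule bwd[of i w]) (use Suc nxt in auto)
    then show ?case using Suc by simp
  qed blast
  then obtain w0 where w0: "Pair 0 w0 \<in> Y" by blast
  \<comment> \<open>Going forwards from fibre 0, the first step flips the point and later steps keep
    it.\<close>
  have step: "Pair (Suc i) (\<not> w) \<in> Y" if w: "Pair 0 w \<in> Y" and "Suc i < m" for i w
    using that(2)
  proof (induction i)
    case 0
    then show ?case using fwd[OF w, of "\<not> w"] nxt[of 0] by simp
  next
    case (Suc i)
    then show ?case using fwd[of "Suc i" "\<not> w" "\<not> w"] nxt[of "Suc i"] by simp
  qed
  \<comment> \<open>The matching from fibre \<open>m - 1\<close> back to 0 is untwisted, so the tour
    ends at the other point of fibre 0.\<close>
  have "Pair 0 (\<not> w) \<in> Y" if "Pair 0 w \<in> Y" for w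
  proof -
    obtain k where k: "m = Suc (Suc k)" using m by (metis One_nat_def less_natE add_Suc_shift plus_1_eq_Suc)
    then have "Pair (Suc k) (\<not> w) \<in> Y" using step[OF that] by simp
    moreover have "nxt (Suc k) = 0" using k by (simp add: nxt_def)
    ultimately show ?thesis using fwd[of "Suc k" "\<not> w" "\<not> w"] k by simp
  qed
  then have zero: "Pair 0 w \<in> Y" for w using w0 by (cases "w = w0") auto
  show ?thesis
  proof (cases j)
    case (Suc k)
    then show ?thesis using step[OF zero[of "\<not> w'"], of k] j by simp
  qed (simp add: zero)
qed

text \<open>The image of one of the two untwisted cycles would be closed under \<open>joined\<close>
  in the twisted order, hence contain all pair points, including the image of a point of the other
  cycle.\<close>

lemma not_isomorphic: "\<not> order_isomorphic Q1 Q2"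
proof
  assume "order_isomorphic Q1 Q2"
  then obtain f where f: "iso Q1 Q2 f" by (auto simp: order_isomorphic_def)
  define X where "X = {Pair i False | i. i < m}"
  have m: "0 < m" using m_ge by simp
  have Xp: "X \<subseteq> pts" by (auto simp: X_def pts_def)
  have X: "d \<in> X" if "c \<in> X" "joined (\<lambda>i. False) c d" for c d
    using that unfolding X_def joined_def balanced_def is_pair_def by (auto simp: pts_def)
  have closed: "d \<in> f ` X" if c: "c \<in> f ` X" and cd: "joined (\<lambda>i. i = 0) c d" for c d
  proof -
    have "d \<in> pts" using cd by (simp add: joined_def)
    then obtain d' where d': "d' \<in> pts" "d = f d'" using f_image[OF f] by blast
    obtain c' where c': "c' \<in> X" "c = f c'" using c by blast
    then have "joined (\<lambda>i. False) c' d'" using cd d' Xp f_joined[OF f] by blast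
    then show ?thesis using X c' d' by blast
  qed
  have pair: "\<exists>i w. i < m \<and> f (Pair 0 u) = Pair i w" for u
    using f_pair[OF f, of "Pair 0 u"] f_pts[OF f, of "Pair 0 u"] m by (auto simp: is_pair_def pts_def)
  obtain i w where i: "i < m" "f (Pair 0 False) = Pair i w" using pair by blast
  obtain j w' where j: "j < m" "f (Pair 0 True) = Pair j w'" using pair by blast
  have "Pair 0 False \<in> X" using m by (auto simp: X_def)
  then have "Pair i w \<in> f ` X" using i(2) by (metis imageI)
  then have "Pair j w' \<in> f ` X"
    by (intro twisted_connected[of "f ` X" i w, OF closed _ i(1) j(1)])
  then obtain x where "x \<in> X" "f x = f (Pair 0 True)" using j(2) by auto
  moreover have "Pair 0 True \<in> pts" using m by (simp add: pts_def)
  ultimately have "Pair 0 True \<in> X" using iso_inj[OF f] Xp by (auto simp: inj_on_def)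
  then show False by (simp add: X_def)
qed

section \<open>Copies on the natural numbers\<close>

definition N :: "(nat \<Rightarrow> bool) \<Rightarrow> nat rel" where
  "N t = {(to_nat x, to_nat y) | x y. (x, y) \<in> Ord t}"

lemma iso_N: "iso (Ord t) (N t) to_nat"
proof -
  have "Field (N t) = to_nat ` Field (Ord t)" by (force simp: Field_def N_def)
  then show ?thesis by (auto simp: iso_iff2 N_def bij_betw_def inj_on_def)
qed

lemma fin_N: "fin_ordered_set (N t)"
  using iso_fin_ordered_set[OF fin_Ord iso_N] .

lemma Field_N: "Field (N t) = to_nat ` pts"
  using iso_image[OF iso_N] by simp

lemma maximals_N: "maximals (N t) = to_nat ` links K"
  using maximals_iso[OF iso_N] by (simp add: maximals_Ord)

lemma minimals_N: "minimals (N t) = to_nat ` links 0"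
  using minimals_iso[OF iso_N] by (simp add: minimals_Ord)

lemma rank_level_N: "rank_level (N t) k = to_nat ` {x \<in> pts. rk x = k}"
  using rank_level_iso[OF fin_Ord iso_N ranked_Ord] by (simp add: rank_level_Ord)

lemma rank_level_N_links: "k = 0 \<or> 4 \<le> k \<Longrightarrow> rank_level (N t) k = to_nat ` links k"
  using rank_level_iso[OF fin_Ord iso_N ranked_Ord] by (simp add: rank_level_links)

lemma card_links_N: "r \<le> K \<Longrightarrow> S \<le> card (to_nat ` links r)"
  using card_links by (simp add: card_image inj_on_def)

abbreviation N1 :: "nat rel" where "N1 \<equiv> N (\<lambda>i. False)"
abbreviation N2 :: "nat rel" where "N2 \<equiv> N (\<lambda>i. i = 0)"

lemma links_N:
  assumes "i < m"
  shows "marked_cards_iso N1 N2 (to_nat (Link i)) (to_nat (Link i))"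
    and "cards_iso N1 N2 (to_nat (Link i)) (to_nat (Link i))"
    and "nbhds_iso N1 N2 (to_nat (Link i)) (to_nat (Link i))"
proof -
  have i: "Link i \<in> Field (Ord t)" for t using assms by (simp add: pts_def)
  note iso = fin_Ord fin_Ord iso_N iso_N i i
  show "marked_cards_iso N1 N2 (to_nat (Link i)) (to_nat (Link i))"
    by (rule marked_cards_iso_iso[OF iso ranked_Ord ranked_Ord marked_links(1)[OF assms]])
  show "cards_iso N1 N2 (to_nat (Link i)) (to_nat (Link i))"
    using marked_links(2)[OF assms] by (simp only: cards_iso_iso[OF iso])
  show "nbhds_iso N1 N2 (to_nat (Link i)) (to_nat (Link i))"
    using nbhds_links[OF assms] by (simp only: nbhds_iso_iso[OF iso])
qed

text \<open>Links are the same points in both orders, so the identity serves as the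
  bijection.\<close>

lemma matched_links_N:
  assumes "\<And>i. i < m \<Longrightarrow> R (to_nat (Link i)) (to_nat (Link i))"
  shows "matched R (to_nat ` links r) (to_nat ` links r)"
  unfolding matched_def using assms by (intro exI[of _ id]) (auto simp: links_def)

lemma matched_nbhds_N: "matched (nbhds_iso N1 N2) (rank_level N1 k) (rank_level N2 k)"
proof -
  have "matched (nbhds_iso N1 N2) (to_nat ` rank_level Q1 k) (to_nat ` rank_level Q2 k)"
    by (rule matched_image[OF matched_nbhds])
      (auto simp: inj_on_def rank_level_def nbhds_iso_iso[OF fin_Ord fin_Ord iso_N iso_N])
  then show ?thesis
    by (simp add: rank_level_iso[OF fin_Ord iso_N ranked_Ord])
qed

text \<open>The links pair off identically, giving \<open>m\<close> cards among at most
  \<open>7 * m\<close> points, and 1/7 exceeds 1/10.\<close>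

lemma ECR_N: "1 / 10 \<le> ECR N1 N2"
proof -
  let ?A = "to_nat ` Link ` {..<m}"
  have m: "0 < m" using m_ge by simp
  have A: "?A \<subseteq> Field (N t)" for t by (auto simp: Field_N pts_def)
  have cA: "card ?A = m" by (simp add: card_image inj_on_def)
  have "card (Field N1) = card pts" by (simp add: Field_N card_image inj_on_def)
  \<comment> \<open>The lower bound makes the denominator positive.\<close>
  then have "card (Field N1) \<le> 7 * m" "m \<le> card (Field N1)"
    using card_pts card_mono[OF _ A] cA finite_pts by (auto simp: Field_N)
  then have "1 / 10 \<le> real (card ?A) / real (card (Field N1))"
    using m cA by (simp add: field_simps)
  also have "matched (cards_iso N1 N2) ?A ?A"
    unfolding matched_def using links_N(2) by (intro exI[of _ id]) auto
  then have "real (card ?A) / real (card (Field N1)) \<le> ECR N1 N2"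
    by (rule ECR_ge[OF fin_N A A])
  finally show ?thesis .
qed

lemma not_isomorphic_N: "\<not> order_isomorphic N1 N2"
  using not_isomorphic order_isomorphic_iso[OF iso_N iso_N] by blast

lemma link_of_rank_N:
  assumes "rank_level N1 k \<noteq> {} \<or> rank_level N2 k \<noteq> {}"
  shows "\<exists>x \<in> rank_level N1 k. \<exists>y \<in> rank_level N2 k. marked_cards_iso N1 N2 x y \<and> nbhds_iso N1 N2 x y"
proof -
  obtain x where "x \<in> pts" "rk x = k" using assms by (auto simp: rank_level_N)
  then obtain i where i: "i < m" "\<rho> i = k" using link_rank by metis
  then have "to_nat (Link i) \<in> rank_level (N t) k" for t
    by (simp add: rank_level_N pts_def)
  then show ?thesis using links_N[OF i(1)] by blast
qed

lemma links_disjoint: "r \<noteq> r' \<Longrightarrow> to_nat ` links r \<inter> to_nat ` links r' = {}"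
  by (auto simp: links_def)

lemma special_ranks:
  assumes n: "n + 4 \<le> K" and c: "c \<le> S"
  shows "\<exists>r :: nat \<Rightarrow> nat. inj_on r {0..n} \<and>
    (\<forall>i\<in>{0..n}. rank_level N1 (r i) \<noteq> {} \<and> rank_level N2 (r i) \<noteq> {} \<and>
       matched (\<lambda>x y. marked_cards_iso N1 N2 x y \<and> nbhds_iso N1 N2 x y)
         (rank_level N1 (r i)) (rank_level N2 (r i)) \<and>
       card (rank_level N1 (r i)) \<ge> c \<and> card (rank_level N2 (r i)) \<ge> c) \<and>
    (\<forall>i\<in>{1..n}. rank_level N1 (r i) \<inter> (maximals N1 \<union> minimals N1) = {} \<and>
                rank_level N2 (r i) \<inter> (maximals N2 \<union> minimals N2) = {})"
proof -
  \<comment> \<open>Rank 0 and the ranks 4 to \<open>n + 3\<close> consist of links alone; all but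
    rank 0 lie strictly between 0 and \<open>K\<close>, away from the extremal points.\<close>
  define r :: "nat \<Rightarrow> nat" where "r i = (if i = 0 then 0 else i + 3)" for i
  have r: "rank_level (N t) (r i) = to_nat ` links (r i)" for t i
    by (rule rank_level_N_links) (auto simp: r_def)
  have le: "r i \<le> K" if "i \<in> {0..n}" for i using that n by (auto simp: r_def)
  have "to_nat ` links (r i) \<noteq> {}" "c \<le> card (to_nat ` links (r i))" if "i \<in> {0..n}" for i
    using links_nonempty[OF le[OF that]] card_links_N[OF le[OF that]] c by auto
  moreover have "to_nat ` links (r i) \<inter> (to_nat ` links K \<union> to_nat ` links 0) = {}"
    if "i \<in> {1..n}" for i
    using that n links_disjoint[of "r i" K] links_disjoint[of "r i" 0]
    by (simp add: r_def Int_Un_distrib)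
  moreover have "matched (\<lambda>x y. marked_cards_iso N1 N2 x y \<and> nbhds_iso N1 N2 x y)
      (to_nat ` links (r i)) (to_nat ` links (r i))" for i
    by (intro matched_links_N conjI links_N)
  moreover have "inj_on r {0..n}" by (auto simp: r_def inj_on_def split: if_splits)
  ultimately show ?thesis
    unfolding maximals_N minimals_N by (intro exI[of _ r]) (simp add: r)
qed

end

theorem theorem4p3:
  fixes s :: "nat \<Rightarrow> nat"
  shows "\<exists>(Q1 :: nat \<Rightarrow> nat rel) (Q2 :: nat \<Rightarrow> nat rel).
    (\<forall>n\<ge>1.
      fin_ordered_set (Q1 n) \<and> fin_ordered_set (Q2 n) \<and>
      \<not> order_isomorphic (Q1 n) (Q2 n) \<and>
      matched (\<lambda>x y. cards_iso (Q1 n) (Q2 n) x y \<and> nbhds_iso (Q1 n) (Q2 n) x y)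
        (maximals (Q1 n)) (maximals (Q2 n)) \<and>
      matched (\<lambda>x y. cards_iso (Q1 n) (Q2 n) x y \<and> nbhds_iso (Q1 n) (Q2 n) x y)
        (minimals (Q1 n)) (minimals (Q2 n)) \<and>
      (\<exists>r :: nat \<Rightarrow> nat. inj_on r {0..n} \<and>
        (\<forall>i\<in>{0..n}. rank_level (Q1 n) (r i) \<noteq> {} \<and> rank_level (Q2 n) (r i) \<noteq> {} \<and>
           matched (\<lambda>x y. marked_cards_iso (Q1 n) (Q2 n) x y \<and> nbhds_iso (Q1 n) (Q2 n) x y)
             (rank_level (Q1 n) (r i)) (rank_level (Q2 n) (r i)) \<and>
           card (rank_level (Q1 n) (r i)) \<ge> s n \<and> card (rank_level (Q2 n) (r i)) \<ge> s n) \<and>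
        (\<forall>i\<in>{1..n}. rank_level (Q1 n) (r i) \<inter> (maximals (Q1 n) \<union> minimals (Q1 n)) = {} \<and>
                    rank_level (Q2 n) (r i) \<inter> (maximals (Q2 n) \<union> minimals (Q2 n)) = {})) \<and>
      (\<forall>k. rank_level (Q1 n) k \<noteq> {} \<or> rank_level (Q2 n) k \<noteq> {} \<longrightarrow>
        (\<exists>x\<in>rank_level (Q1 n) k. \<exists>y\<in>rank_level (Q2 n) k.
           marked_cards_iso (Q1 n) (Q2 n) x y \<and> nbhds_iso (Q1 n) (Q2 n) x y)) \<and>
      (\<forall>k. matched (nbhds_iso (Q1 n) (Q2 n)) (rank_level (Q1 n) k) (rank_level (Q2 n) k)) \<and>
      card (maximals (Q1 n)) \<ge> s n \<and> card (maximals (Q2 n)) \<ge> s n \<and>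
      card (minimals (Q1 n)) \<ge> s n \<and> card (minimals (Q2 n)) \<ge> s n) \<and>
    liminf (\<lambda>n. ereal (ECR (Q1 n) (Q2 n))) \<ge> ereal (1 / 10)"
proof -
  \<comment> \<open>The first parameter supplies at least \<open>s n\<close> links per rank, the
    second leaves room for the ranks 4 to \<open>n + 3\<close> below the top; the added 4 meets the
    locale's bounds.\<close>
  have cyc: "cyclic (s n + 4) (n + 4)" for n by unfold_locales auto
  define Q1 where "Q1 n = cyclic.N (s n + 4) (n + 4) (\<lambda>i. False)" for n
  define Q2 where "Q2 n = cyclic.N (s n + 4) (n + 4) (\<lambda>i. i = 0)" for n
  have "1 / 10 \<le> ECR (Q1 n) (Q2 n)" for n
    unfolding Q1_def Q2_def by (rule cyclic.ECR_N[OF cyc])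
  then have liminf: "liminf (\<lambda>n. ereal (ECR (Q1 n) (Q2 n))) \<ge> ereal (1 / 10)"
    by (intro Liminf_bounded always_eventually) simp
  show ?thesis
  proof (rule exI[of _ Q1], rule exI[of _ Q2], rule conjI[OF _ liminf], intro allI impI, goal_cases)
    case (1 n)
    interpret cyclic "s n + 4" "n + 4" by (rule cyc)
    have Q: "Q1 n = N1" "Q2 n = N2" by (simp_all add: Q1_def Q2_def)
    have decks: "matched (\<lambda>x y. cards_iso N1 N2 x y \<and> nbhds_iso N1 N2 x y)
        (maximals N1) (maximals N2)"
      "matched (\<lambda>x y. cards_iso N1 N2 x y \<and> nbhds_iso N1 N2 x y) (minimals N1) (minimals N2)"
      unfolding maximals_N minimals_N by (intro matched_links_N conjI links_N; assumption)+
    have "card (maximals (N t)) \<ge> s n" "card (minimals (N t)) \<ge> s n" for t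
      using card_links_N[of "n + 4"] card_links_N[of 0] unfolding maximals_N minimals_N by simp_all
    moreover note special_ranks[of n "s n"]
    ultimately show ?case
      unfolding Q using fin_N not_isomorphic_N decks link_of_rank_N matched_nbhds_N by simp
  qed
qed

end
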